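(* Let $G=(V,E)$ be a finite simple undirected graph, let $\mathcal{G}=(\mathcal{V},\mathcal{E})$ be a lossless summary of $G$, and let $u,v\in V$ be distinct nodes with $S(u)=S(v)$, where $S(x)$ denotes the supernode containing $x$. Let $d(u,v)$ denote the length of a shortest path between $u$ and $v$ in $G$ ($d(u,v)=\infty$ if none exists). Then: (1) if $S(u)$ is a clique supernode, $d(u,v)=1$; (2) if $S(u)$ is an independent set supernode and $|N(S(u))|>0$, then $d(u,v)=2$, and otherwise $d(u,v)=\infty$.
   Context: A summary of $G$ is a pair $(\mathcal{V},\mathcal{E})$ where $\mathcal{V}$ is a partition of $V$ into nonempty sets (supernodes) and $\mathcal{E}$ a set of unordered pairs $\{S_i,S_j\}$ of supernodes ($i=j$ allowed, a self-loop), called superedges. Its reconstruction is the simple graph on $V$ containing, for each superedge $\{S_i,S_j\}$ with $i\neq j$, all pairs $\{x,y\}$ with $x\in S_i, y\in S_j$, and for each self-loop $\{S_i,S_i\}$, all pairs of distinct nodes of $S_i$. The summary is lossless if its reconstruction equals $G$. A supernode of size at least two is a clique supernode if it carries a self-loop and an independent set supernode otherwise. $N(X)$ denotes the set of supernodes $Y\neq X$ such that $\{X,Y\}\in\mathcal{E}$. *)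

theory Defs
  imports
    "Graph_Theory.Pair_Digraph"
    "Graph_Theory.Shortest_Path"
    "HOL-Library.Disjoint_Sets"
begin

(* Finite simple undirected graphs are the symmetric loop-free finite digraphs of pair_graph:
   the edge {x, y} is the pair of arcs (x, y), (y, x). *)

(* The superedge {X, Y} is the set {X, Y} itself, so a self-loop is the singleton {X}. *)
definition is_summary :: "'a set \<Rightarrow> 'a set set \<Rightarrow> 'a set set set \<Rightarrow> bool" where
  "is_summary V \<V> \<E> \<longleftrightarrow>
     partition_on V \<V> \<and> (\<forall>e\<in>\<E>. \<exists>X\<in>\<V>. \<exists>Y\<in>\<V>. e = {X, Y})"

definition reconstruction :: "'a set \<Rightarrow> 'a set set set \<Rightarrow> 'a pair_pre_digraph" where
  "reconstruction V \<E> =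
     \<lparr> pverts = V,
       parcs = {(x, y). \<exists>X Y. {X, Y} \<in> \<E> \<and> X \<noteq> Y \<and> x \<in> X \<and> y \<in> Y}
             \<union> {(x, y). \<exists>X. {X} \<in> \<E> \<and> x \<in> X \<and> y \<in> X \<and> x \<noteq> y} \<rparr>"

definition lossless_summary ::
  "'a pair_pre_digraph \<Rightarrow> 'a set set \<Rightarrow> 'a set set set \<Rightarrow> bool" where
  "lossless_summary G \<V> \<E> \<longleftrightarrow>
     is_summary (pverts G) \<V> \<E> \<and> reconstruction (pverts G) \<E> = G"

definition supernode_of :: "'a set set \<Rightarrow> 'a \<Rightarrow> 'a set" where
  "supernode_of \<V> x = (THE X. X \<in> \<V> \<and> x \<in> X)"

definition clique_supernode :: "'a set set \<Rightarrow> 'a set set set \<Rightarrow> 'a set \<Rightarrow> bool" where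
  "clique_supernode \<V> \<E> X \<longleftrightarrow> X \<in> \<V> \<and> card X \<ge> 2 \<and> {X} \<in> \<E>"

definition independent_supernode :: "'a set set \<Rightarrow> 'a set set set \<Rightarrow> 'a set \<Rightarrow> bool" where
  "independent_supernode \<V> \<E> X \<longleftrightarrow> X \<in> \<V> \<and> card X \<ge> 2 \<and> {X} \<notin> \<E>"

definition supernode_neighbours :: "'a set set \<Rightarrow> 'a set set set \<Rightarrow> 'a set \<Rightarrow> 'a set set" where
  "supernode_neighbours \<V> \<E> X = {Y \<in> \<V>. Y \<noteq> X \<and> {X, Y} \<in> \<E>}"

lemma (in wf_digraph) unit_cost_\<mu>_eq_shortest_path:
  "\<mu> (\<lambda>_. 1) u v = (INF p \<in> {p. apath u p v}. ereal (real (length p)))"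
proof -
  have cost: "awalk_cost (\<lambda>_. 1) p = real (length p)" for p
    by (induction p) auto
  have short: "\<exists>q. apath u q v \<and> length q \<le> length p" if "awalk u p v" for p
    using that
  proof (induction rule: awalk_to_apath_induct)
    case (path p)
    then show ?case unfolding apath_def by blast
  next
    case (decomp p q r s)
    have "p = q @ r @ s"
      using decomp.hyps by (auto elim: awalk_cyc_decompE)
    with decomp.IH show ?case by fastforce
  qed
  show ?thesis
    unfolding \<mu>_def cost
    by (intro antisym INF_mono) (use short apath_def in auto)
qed

(* wf_digraph.\<mu> is the infimum of the costs of all walks from u to v, here with every arc of
   cost 1; it is \<infinity> if there is no walk.  By the lemma above, this is the length of a shortest
   path. *)
definition graph_dist :: "'a pair_pre_digraph \<Rightarrow> 'a \<Rightarrow> 'a \<Rightarrow> ereal" where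
  "graph_dist G u v = wf_digraph.\<mu> (with_proj G) (\<lambda>_. 1) u v"

end

theory Submission
  imports Defs
begin

text \<open>Losslessness makes adjacency of distinct nodes a property of their supernodes alone
  (\<open>lossless_summary_arc_iff\<close>), so two nodes of one supernode are twins: adjacent
  exactly when it carries a self-loop, and with the same neighbours outside it. In a clique
  supernode they are at distance 1. In an independent set supernode they are not adjacent; any node
  of a neighbouring supernode is a common neighbour, giving distance 2, and without such a supernode
  no arc leaves \<open>u\<close>, so \<open>v\<close> is unreachable. The three
  \<open>graph_dist_...\<close> lemmas turn these local situations into distances.\<close>

context pair_wf_digraph
begin

lemma graph_dist_eq_apath_length:
  "graph_dist G u v = (INF p \<in> {p. apath u p v}. ereal (real (length p)))"
  unfolding graph_dist_def by (rule unit_cost_\<mu>_eq_shortest_path)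

lemma graph_dist_adjacent:
  assumes "(u, v) \<in> parcs G" "u \<noteq> v"
  shows "graph_dist G u v = 1"
proof -
  have "apath u [(u, v)] v"
    using assms by (auto simp: apath_Cons_iff apath_Nil_iff in_arcsD2)
  moreover have "length p \<ge> 1" if "apath u p v" for p
    using that assms by (cases p) (auto simp: apath_def awalk_Nil_iff)
  ultimately show ?thesis
    unfolding graph_dist_eq_apath_length
    by (intro antisym INF_lower2[of "[(u, v)]"] INF_greatest) (auto simp: one_ereal_def)
qed

lemma graph_dist_common_neighbour:
  assumes "(u, w) \<in> parcs G" "(w, v) \<in> parcs G" "(u, v) \<notin> parcs G"
    and "u \<noteq> v" "u \<noteq> w" "w \<noteq> v"
  shows "graph_dist G u v = 2"
proof -
  have "apath u [(u, w), (w, v)] v"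
    using assms by (auto simp: apath_Cons_iff apath_Nil_iff in_arcsD2)
  moreover have "length p \<ge> 2" if "apath u p v" for p
  proof (rule ccontr)
    assume "\<not> length p \<ge> 2"
    \<comment> \<open>The empty path would force \<open>u = v\<close>, a single arc would be
      \<open>(u, v)\<close>.\<close>
    then consider "p = []" | e where "p = [e]"
      by (cases p; cases "tl p") auto
    then show False
      using that assms by cases (auto simp: apath_def awalk_Cons_iff awalk_Nil_iff)
  qed
  ultimately show ?thesis
    unfolding graph_dist_eq_apath_length
    by (intro antisym INF_lower2[of "[(u, w), (w, v)]"] INF_greatest) auto
qed

lemma graph_dist_isolated:
  assumes "\<And>w. (u, w) \<notin> parcs G" "u \<noteq> v"
  shows "graph_dist G u v = \<infinity>"
proof -
  have "\<not> apath u p v" for p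
    using assms by (cases p) (auto simp: apath_def awalk_Cons_iff awalk_Nil_iff)
  \<comment> \<open>The infimum over the empty set of paths is \<open>top\<close>, which is
    \<infinity> in \<open>ereal\<close>.\<close>
  then show ?thesis
    unfolding graph_dist_eq_apath_length by (simp add: top_ereal_def)
qed

end

lemma supernode_of_eq:
  assumes "partition_on V \<V>" "X \<in> \<V>" "x \<in> X"
  shows "supernode_of \<V> x = X"
  unfolding supernode_of_def
  using assms by (intro the_equality) (auto simp: partition_on_def dest: disjointD)

lemma supernode_of_mem:
  assumes "partition_on V \<V>" "x \<in> V"
  shows "supernode_of \<V> x \<in> \<V>" "x \<in> supernode_of \<V> x"
  using assms supernode_of_eq[OF assms(1)] by (force simp: partition_on_def)+

lemma lossless_summary_arc_iff:
  assumes "lossless_summary G \<V> \<E>" "x \<in> pverts G" "y \<in> pverts G"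
  shows "(x, y) \<in> parcs G \<longleftrightarrow> x \<noteq> y \<and> {supernode_of \<V> x, supernode_of \<V> y} \<in> \<E>"
proof -
  have part: "partition_on (pverts G) \<V>"
    and superedge: "\<And>e. e \<in> \<E> \<Longrightarrow> \<exists>X\<in>\<V>. \<exists>Y\<in>\<V>. e = {X, Y}"
    and arcs: "parcs G = parcs (reconstruction (pverts G) \<E>)"
    using assms(1) by (simp_all add: lossless_summary_def is_summary_def)
  note S = supernode_of_mem[OF part]
  \<comment> \<open>\<open>reconstruction\<close> quantifies over arbitrary sets; that they are
    supernodes comes from the shape of superedges.\<close>
  have supernodes: "X \<in> \<V> \<and> Y \<in> \<V>" if "{X, Y} \<in> \<E>" for X Y
    using superedge[OF that] by (auto simp: doubleton_eq_iff)
  show ?thesis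
  proof
    assume "(x, y) \<in> parcs G"
    then consider X Y where "{X, Y} \<in> \<E>" "X \<noteq> Y" "x \<in> X" "y \<in> Y"
      | X where "{X, X} \<in> \<E>" "x \<in> X" "y \<in> X" "x \<noteq> y"
      unfolding arcs reconstruction_def by auto
    then show "x \<noteq> y \<and> {supernode_of \<V> x, supernode_of \<V> y} \<in> \<E>"
      using supernodes supernode_of_eq[OF part] by cases metis+
  next
    assume "x \<noteq> y \<and> {supernode_of \<V> x, supernode_of \<V> y} \<in> \<E>"
    then show "(x, y) \<in> parcs G"
      using S[OF assms(2)] S[OF assms(3)]
      unfolding arcs reconstruction_def
      by (cases "supernode_of \<V> x = supernode_of \<V> y") auto
  qed
qed

theorem theorem3p6:
  fixes G :: "'a pair_pre_digraph"
    and \<V> :: "'a set set"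
    and \<E> :: "'a set set set"
    and u v :: 'a
  assumes "pair_graph G"
    and "lossless_summary G \<V> \<E>"
    and "u \<in> pverts G" and "v \<in> pverts G" and "u \<noteq> v"
    and "supernode_of \<V> u = supernode_of \<V> v"
  shows "(clique_supernode \<V> \<E> (supernode_of \<V> u) \<longrightarrow> graph_dist G u v = 1) \<and>
    (independent_supernode \<V> \<E> (supernode_of \<V> u) \<longrightarrow>
       (if card (supernode_neighbours \<V> \<E> (supernode_of \<V> u)) > 0
        then graph_dist G u v = 2
        else graph_dist G u v = \<infinity>))"
proof -
  interpret pair_graph G by fact
  let ?S = "supernode_of \<V>"
  have part: "partition_on (pverts G) \<V>"
    using assms(2) by (simp add: lossless_summary_def is_summary_def)
  note arc_iff = lossless_summary_arc_iff[OF assms(2)]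
  \<comment> \<open>An infinite set has \<open>card\<close> 0, so finiteness is what makes positive
    cardinality mean nonempty.\<close>
  have fin: "finite (supernode_neighbours \<V> \<E> (?S u))"
    using finite_elements[OF _ part] by (simp add: supernode_neighbours_def)
  show ?thesis
  proof (intro conjI impI)
    assume "clique_supernode \<V> \<E> (?S u)"
    then show "graph_dist G u v = 1"
      using assms by (intro graph_dist_adjacent) (auto simp: arc_iff clique_supernode_def)
  next
    assume "independent_supernode \<V> \<E> (?S u)"
    then have no_loop: "{?S u} \<notin> \<E>"
      by (simp add: independent_supernode_def)
    show "if card (supernode_neighbours \<V> \<E> (?S u)) > 0
        then graph_dist G u v = 2 else graph_dist G u v = \<infinity>"
    proof (cases "supernode_neighbours \<V> \<E> (?S u) = {}")
      case False
      then obtain Y where Y: "Y \<in> \<V>" "Y \<noteq> ?S u" "{?S u, Y} \<in> \<E>"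
        by (auto simp: supernode_neighbours_def)
      \<comment> \<open>Blocks of a partition are nonempty; any \<open>w\<close> in \<open>Y\<close>
        is adjacent to both \<open>u\<close> and \<open>v\<close>.\<close>
      then obtain w where "w \<in> Y" "w \<in> pverts G"
        using part unfolding partition_on_def by (metis Union_iff all_not_in_conv)
      moreover from this have "?S w = Y"
        using supernode_of_eq[OF part] Y by blast
      ultimately have "graph_dist G u v = 2"
        using assms Y no_loop
        by (intro graph_dist_common_neighbour[of u w]) (auto simp: arc_iff insert_commute)
      with False fin show ?thesis
        by (simp add: card_gt_0_iff)
    next
      case True
      have "(u, w) \<notin> parcs G" for w
      proof
        assume arc: "(u, w) \<in> parcs G"
        then have "w \<in> pverts G"
          using in_arcsD2 by blast
        with arc have "?S w \<in> \<V>" "{?S u, ?S w} \<in> \<E>"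
          using supernode_of_mem[OF part] arc_iff assms(3) by auto
        \<comment> \<open>The superedge behind the arc would be a self-loop at \<open>?S u\<close>
          or would make \<open>?S w\<close> a neighbour of it.\<close>
        with no_loop True show False
          by (cases "?S w = ?S u") (auto simp: supernode_neighbours_def)
      qed
      then show ?thesis
        using True assms(5) graph_dist_isolated by simp
    qed
  qed
qed

end
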